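(* Let $(P,\preceq)$ be a lattice, let $S=\{x_1,\ldots,x_n\}$ be a finite subset of $P$ with distinct elements such that $x_i\preceq x_j\Rightarrow i\leq j$, and let $f_1,\ldots,f_n:P\to\mathbb{C}$. Suppose that $S$ is join closed. Then the row-adjusted join matrix $[S]_{f_1,\ldots,f_n}=(f_i(x_i\vee x_j))_{i,j=1}^n$ is invertible if and only if $\Psi_{S,f_i}'(x_i)\neq 0$ for all $i=1,\ldots,n$. Furthermore, in this case the inverse of $[S]_{f_1,\ldots,f_n}$ is the $n\times n$ matrix $B'=(b_{ij}')$ with $$b_{ij}'=\sum_{k=1}^j\mu_S(x_k,x_i)\theta_{kj}',$$ where for each $j$ the numbers $\theta_{jj}',\theta_{j-1,j}',\ldots,\theta_{1j}'$ are defined recursively by $$\theta_{jj}'=\frac{1}{\Psi_{S,f_j}'(x_j)},\qquad \theta_{kj}'=-\frac{1}{\Psi_{S,f_k}'(x_k)}\sum_{u=k+1}^{j}e_{ku}'\Psi_{S,f_k}'(x_u)\theta_{uj}'\quad\text{if }j>k.$$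
   Context: $S$ is join closed if $x\vee y\in S$ for all $x,y\in S$. For each $i=1,\ldots,n$ the function $\Psi_{S,f_i}':S\to\mathbb{C}$ is defined inductively (downwards) by $$\Psi_{S,f_i}'(x_k)=f_i(x_k)-\sum_{x_k\prec x_v}\Psi_{S,f_i}'(x_v),$$ the sum being over $x_v\in S$; equivalently, $f_i(x_k)=\sum_{x_k\preceq x_v}\Psi_{S,f_i}'(x_v)$ for all $k$. The numbers $e_{ku}'$ are given by $e_{ku}'=1$ if $x_k\preceq x_u$ and $e_{ku}'=0$ otherwise. $\mu_S$ is the Möbius function of the finite poset $(S,\preceq)$, with the convention $\mu_S(x,y)=0$ if $x\not\preceq y$. *)

theory Defs
  imports Complex_Main "Jordan_Normal_Form.Matrix"
begin

text \<open>
  The elements of the finite set are enumerated as \<open>x 0, \<dots>, x (n - 1)\<close>, and matrices,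
  functions \<open>f i\<close> and sums are indexed from 0 accordingly.
\<close>

definition join_closed :: "'a::lattice set \<Rightarrow> bool" where
  "join_closed S \<longleftrightarrow> (\<forall>x\<in>S. \<forall>y\<in>S. sup x y \<in> S)"

text \<open>
  The functions \<open>Psi'\<close> and the Moebius function are recursions along a finite poset
  \<open>S\<close>. The value 0 for infinite \<open>S\<close> only serves to make them total, and
  only their values at elements of \<open>S\<close> are meaningful.
\<close>

function Psi' :: "'a::order set \<Rightarrow> ('a \<Rightarrow> complex) \<Rightarrow> 'a \<Rightarrow> complex" where
  "Psi' S f x = (if finite S then f x - (\<Sum>y\<in>{y\<in>S. x < y}. Psi' S f y) else 0)"
  by pat_completeness auto
termination
proof (relation "measure (\<lambda>(S, f, x). card {y\<in>S. x < y})", goal_cases)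
  case 1
  show ?case by simp
next
  case (2 S f x y)
  then have "{z\<in>S. y < z} \<subset> {z\<in>S. x < z}" and "finite {z\<in>S. x < z}"
    by auto
  then show ?case
    by (simp add: psubset_card_mono)
qed

function moebius :: "'a::order set \<Rightarrow> 'a \<Rightarrow> 'a \<Rightarrow> int" where
  "moebius S x y =
     (if finite S then
        if x = y then 1
        else if x < y then - (\<Sum>z\<in>{z\<in>S. x \<le> z \<and> z < y}. moebius S x z)
        else 0
      else 0)"
  by pat_completeness auto
termination
proof (relation "measure (\<lambda>(S, x, y). card {z\<in>S. x \<le> z \<and> z < y})", goal_cases)
  case 1
  show ?case by simp
next
  case (2 S x y z)
  then have "{w\<in>S. x \<le> w \<and> w < z} \<subset> {w\<in>S. x \<le> w \<and> w < y}"
    and "finite {w\<in>S. x \<le> w \<and> w < y}"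
    by auto
  then show ?case
    by (simp add: psubset_card_mono)
qed

declare Psi'.simps [simp del] moebius.simps [simp del]

definition e' :: "(nat \<Rightarrow> 'a::order) \<Rightarrow> nat \<Rightarrow> nat \<Rightarrow> complex" where
  "e' x k u = (if x k \<le> x u then 1 else 0)"

text \<open>For fixed \<open>j\<close> this is a downward recursion on \<open>k\<close>; the value 0 for \<open>k > j\<close> is never used.\<close>

function theta' ::
    "'a::order set \<Rightarrow> (nat \<Rightarrow> 'a) \<Rightarrow> (nat \<Rightarrow> 'a \<Rightarrow> complex) \<Rightarrow> nat \<Rightarrow> nat \<Rightarrow> complex" where
  "theta' S x f k j =
     (if k = j then 1 / Psi' S (f j) (x j)
      else if k < j then
        - (1 / Psi' S (f k) (x k)) *
          (\<Sum>u\<in>{k + 1..j}. e' x k u * Psi' S (f k) (x u) * theta' S x f u j)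
      else 0)"
  by pat_completeness auto
termination
  by (relation "measure (\<lambda>(S, x, f, k, j). j - k)") auto

declare theta'.simps [simp del]

definition row_adj_join_mat ::
    "nat \<Rightarrow> (nat \<Rightarrow> 'a::lattice) \<Rightarrow> (nat \<Rightarrow> 'a \<Rightarrow> complex) \<Rightarrow> complex mat" where
  "row_adj_join_mat n x f = mat n n (\<lambda>(i, j). f i (sup (x i) (x j)))"

definition B' ::
    "nat \<Rightarrow> 'a::order set \<Rightarrow> (nat \<Rightarrow> 'a) \<Rightarrow> (nat \<Rightarrow> 'a \<Rightarrow> complex) \<Rightarrow> complex mat" where
  "B' n S x f =
     mat n n (\<lambda>(i, j). \<Sum>k\<le>j. of_int (moebius S (x k) (x i)) * theta' S x f k j)"

end

theory Submission imports Defs "Jordan_Normal_Form.Determinant"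
begin

text \<open>
  Expanding \<open>f i\<close> at the join \<open>sup (x i) (x j)\<close> through \<open>Psi'\<close> factors the join matrix as
  \<open>D * Z\<close>, where \<open>D\<close> has entries \<open>e' x i u * Psi' S (f i) (x u)\<close> and \<open>Z\<close> is the transposed zeta
  matrix of \<open>S\<close>. The transposed Moebius matrix is a right inverse of \<open>Z\<close>. The indexing makes \<open>D\<close>
  upper triangular with diagonal \<open>Psi' S (f i) (x i)\<close>, and the recursion for \<open>theta'\<close> is back
  substitution in \<open>D * T = 1\<close>.
\<close>

text \<open>Splitting off the term at \<open>x\<close> leaves exactly the sum that the recursion for
  \<open>Psi'\<close> subtracts from \<open>f x\<close>.\<close>

lemma sum_Psi':
  assumes "finite S" "x \<in> S"
  shows "(\<Sum>y\<in>{y\<in>S. x \<le> y}. Psi' S f y) = f x"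
proof -
  have "{y\<in>S. x \<le> y} = insert x {y\<in>S. x < y}"
    using assms by (auto simp: order.order_iff_strict)
  then show ?thesis
    using assms by (simp add: Psi'.simps[of S f x])
qed

lemma moebius_eq_0:
  assumes "\<not> x \<le> y"
  shows "moebius S x y = 0"
  using assms by (subst moebius.simps) auto

text \<open>For \<open>x < y\<close> the recursion makes the value at the top \<open>y\<close>
  cancel the sum over the rest of the interval; for \<open>x = y\<close> the interval is a single
  point with value 1.\<close>

lemma sum_moebius:
  assumes "finite S" "y \<in> S"
  shows "(\<Sum>z\<in>{z\<in>S. z \<le> y}. moebius S x z) = (if x = y then 1 else 0)"
proof -
  \<comment> \<open>Terms at \<open>z\<close> not above \<open>x\<close> vanish, which cuts the
    down-set of \<open>y\<close> to the interval that the recursion sums over.\<close>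
  have "(\<Sum>z\<in>{z\<in>S. z \<le> y}. moebius S x z) = (\<Sum>z\<in>{z\<in>S. x \<le> z \<and> z \<le> y}. moebius S x z)"
    using assms moebius_eq_0[of x _ S] by (intro sum.mono_neutral_right) (simp, blast+)
  also have "\<dots> = (if x = y then 1 else 0)"
  proof (cases "x \<le> y")
    case True
    then have "{z\<in>S. x \<le> z \<and> z \<le> y} = insert y {z\<in>S. x \<le> z \<and> z < y}"
      using assms by (auto simp: order.order_iff_strict)
    then have sum: "(\<Sum>z\<in>{z\<in>S. x \<le> z \<and> z \<le> y}. moebius S x z) =
        moebius S x y + (\<Sum>z\<in>{z\<in>S. x \<le> z \<and> z < y}. moebius S x z)"
      using assms by simp
    show ?thesis
    proof (cases "x = y")
      case True
      then have "(\<Sum>z\<in>{z\<in>S. x \<le> z \<and> z < y}. moebius S x z) = 0"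
        by (intro sum.neutral) auto
      with True sum assms(1) show ?thesis
        by (simp add: moebius.simps[of S y y])
    next
      case False
      with \<open>x \<le> y\<close> sum assms show ?thesis
        by (simp add: moebius.simps[of S x y])
    qed
  next
    case False
    then have "(\<Sum>z\<in>{z\<in>S. x \<le> z \<and> z \<le> y}. moebius S x z) = 0"
      by (intro sum.neutral) (auto dest: order.trans)
    with False show ?thesis
      by auto
  qed
  finally show ?thesis .
qed

text \<open>With this default value \<open>theta_mat\<close> is upper triangular, so sums up to
  \<open>j\<close> extend to all indices below \<open>n\<close> and become entries of matrix
  products.\<close>

lemma theta'_eq_0: "j < k \<Longrightarrow> theta' S x f k j = 0"
  by (subst theta'.simps) simp

definition psi_mat ::
    "nat \<Rightarrow> 'a::order set \<Rightarrow> (nat \<Rightarrow> 'a) \<Rightarrow> (nat \<Rightarrow> 'a \<Rightarrow> complex) \<Rightarrow> complex mat" where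
  "psi_mat n S x f = mat n n (\<lambda>(i, u). e' x i u * Psi' S (f i) (x u))"

definition zeta_mat :: "nat \<Rightarrow> (nat \<Rightarrow> 'a::order) \<Rightarrow> complex mat" where
  "zeta_mat n x = mat n n (\<lambda>(u, j). e' x j u)"

definition moebius_mat :: "nat \<Rightarrow> 'a::order set \<Rightarrow> (nat \<Rightarrow> 'a) \<Rightarrow> complex mat" where
  "moebius_mat n S x = mat n n (\<lambda>(i, k). of_int (moebius S (x k) (x i)))"

definition theta_mat ::
    "nat \<Rightarrow> 'a::order set \<Rightarrow> (nat \<Rightarrow> 'a) \<Rightarrow> (nat \<Rightarrow> 'a \<Rightarrow> complex) \<Rightarrow> complex mat" where
  "theta_mat n S x f = mat n n (\<lambda>(k, j). theta' S x f k j)"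

lemma mats_carrier [simp]:
  "row_adj_join_mat n x g \<in> carrier_mat n n"
  "B' n S y f \<in> carrier_mat n n"
  "psi_mat n S y f \<in> carrier_mat n n"
  "zeta_mat n y \<in> carrier_mat n n"
  "moebius_mat n S y \<in> carrier_mat n n"
  "theta_mat n S y f \<in> carrier_mat n n"
  by (simp_all add: row_adj_join_mat_def B'_def psi_mat_def zeta_mat_def moebius_mat_def
      theta_mat_def)

lemma mat_times_mat:
  "mat n m g * mat m p h = mat n p (\<lambda>(i, j). \<Sum>u<m. g (i, u) * h (u, j))"
  by (rule eq_matI) (auto simp: scalar_prod_def atLeast0LessThan)

lemma sum_image_filter:
  assumes "inj_on x {..<n::nat}"
  shows "sum g {y \<in> x ` {..<n}. P y} = (\<Sum>u<n. if P (x u) then g (x u) else 0)"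
  using assms by (simp add: sum.inter_filter sum.reindex)

lemma row_adj_join_mat_factor:
  assumes "S = x ` {..<n}" "inj_on x {..<n}" "join_closed S"
  shows "row_adj_join_mat n x f = psi_mat n S x f * zeta_mat n x"
proof -
  have "(\<Sum>u<n. e' x i u * Psi' S (f i) (x u) * e' x j u) = f i (sup (x i) (x j))"
    if "i < n" "j < n" for i j
  proof -
    have "sup (x i) (x j) \<in> S"
      using assms that by (auto simp: join_closed_def)
    then have "f i (sup (x i) (x j)) = (\<Sum>y\<in>{y\<in>S. sup (x i) (x j) \<le> y}. Psi' S (f i) y)"
      using sum_Psi'[of S "sup (x i) (x j)" "f i"] assms(1) by simp
    also have "\<dots> = (\<Sum>u<n. if sup (x i) (x j) \<le> x u then Psi' S (f i) (x u) else 0)"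
      using sum_image_filter[OF assms(2)] unfolding assms(1) .
    \<comment> \<open>An element lies above the join iff it lies above both \<open>x i\<close> and
      \<open>x j\<close>, so the indicator splits into two factors \<open>e'\<close>.\<close>
    also have "\<dots> = (\<Sum>u<n. e' x i u * Psi' S (f i) (x u) * e' x j u)"
      by (intro sum.cong) (auto simp: e'_def)
    finally show ?thesis ..
  qed
  then show ?thesis
    unfolding row_adj_join_mat_def psi_mat_def zeta_mat_def mat_times_mat
    by (intro eq_matI) auto
qed

lemma zeta_mat_times_moebius_mat:
  assumes "S = x ` {..<n}" "inj_on x {..<n}"
  shows "zeta_mat n x * moebius_mat n S x = 1\<^sub>m n"
proof -
  have "(\<Sum>i<n. e' x i u * of_int (moebius S (x k) (x i))) = (if u = k then 1 else 0)"
    if "u < n" "k < n" for u k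
  proof -
    have "(\<Sum>i<n. e' x i u * of_int (moebius S (x k) (x i))) =
        of_int (\<Sum>i<n. if x i \<le> x u then moebius S (x k) (x i) else 0)"
      by (auto simp: e'_def of_int_sum intro!: sum.cong)
    also have "\<dots> = of_int (\<Sum>z\<in>{z\<in>S. z \<le> x u}. moebius S (x k) z)"
      unfolding assms(1) sum_image_filter[OF assms(2)] ..
    \<comment> \<open>Injectivity of \<open>x\<close> turns \<open>x k = x u\<close> into equality
      of the indices.\<close>
    also have "\<dots> = (if u = k then 1 else 0)"
      using that assms by (auto simp: sum_moebius inj_on_def)
    finally show ?thesis .
  qed
  then show ?thesis
    unfolding zeta_mat_def moebius_mat_def mat_times_mat
    by (intro eq_matI) auto
qed

lemma psi_mat_times_theta_mat:
  assumes mono: "\<And>i j. \<lbrakk>i < n; j < n; x i \<le> x j\<rbrakk> \<Longrightarrow> i \<le> j"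
    and nz: "\<And>i. i < n \<Longrightarrow> Psi' S (f i) (x i) \<noteq> 0"
  shows "psi_mat n S x f * theta_mat n S x f = 1\<^sub>m n"
proof -
  have "(\<Sum>u<n. e' x i u * Psi' S (f i) (x u) * theta' S x f u j) = (if i = j then 1 else 0)"
    if "i < n" "j < n" for i j
  proof -
    \<comment> \<open>For \<open>u < i\<close> the order of the indexing gives
      \<open>e' x i u = 0\<close>; for \<open>u > j\<close> the factor \<open>theta'\<close> is
      0.\<close>
    have "(\<Sum>u<n. e' x i u * Psi' S (f i) (x u) * theta' S x f u j) =
        (\<Sum>u\<in>{i..j}. e' x i u * Psi' S (f i) (x u) * theta' S x f u j)"
      using that mono[of i]
      by (intro sum.mono_neutral_right) (auto simp: e'_def theta'_eq_0 not_le)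
    also have "\<dots> = (if i = j then 1 else 0)"
    proof (cases "i < j")
      \<comment> \<open>The term \<open>u = i\<close> is
        \<open>Psi' S (f i) (x i) * theta' S x f i j\<close>, which by the recursion is minus the
        sum of the others.\<close>
      case True
      then show ?thesis
        using nz[OF \<open>i < n\<close>]
        by (simp add: sum.atLeast_Suc_atMost e'_def theta'.simps[of S x f i j])
    next
      \<comment> \<open>The range is empty for \<open>i > j\<close>; for \<open>i = j\<close> its
        only term is \<open>Psi'\<close> times its reciprocal.\<close>
      case False
      then show ?thesis
        using nz[OF \<open>i < n\<close>] by (auto simp: e'_def theta'.simps[of S x f j j])
    qed
    finally show ?thesis .
  qed
  then show ?thesis
    unfolding psi_mat_def theta_mat_def mat_times_mat
    by (intro eq_matI) auto
qed

lemma B'_factor: "B' n S x f = moebius_mat n S x * theta_mat n S x f"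
proof -
  have "(\<Sum>k\<le>j. of_int (moebius S (x k) (x i)) * theta' S x f k j) =
      (\<Sum>k<n. of_int (moebius S (x k) (x i)) * theta' S x f k j)" if "j < n" for i j
    using that by (intro sum.mono_neutral_left) (auto simp: theta'_eq_0)
  then show ?thesis
    unfolding B'_def moebius_mat_def theta_mat_def mat_times_mat
    by (intro eq_matI) auto
qed

lemma row_adj_join_mat_times_B':
  assumes "S = x ` {..<n}" "inj_on x {..<n}" "join_closed S"
    and "\<And>i j. \<lbrakk>i < n; j < n; x i \<le> x j\<rbrakk> \<Longrightarrow> i \<le> j"
    and "\<And>i. i < n \<Longrightarrow> Psi' S (f i) (x i) \<noteq> 0"
  shows "row_adj_join_mat n x f * B' n S x f = 1\<^sub>m n"
proof -
  let ?D = "psi_mat n S x f" and ?Z = "zeta_mat n x"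
    and ?M = "moebius_mat n S x" and ?T = "theta_mat n S x f"
  have "row_adj_join_mat n x f * B' n S x f = ?D * ?Z * (?M * ?T)"
    using row_adj_join_mat_factor[OF assms(1-3)] by (simp add: B'_factor)
  \<comment> \<open>Regrouping brings \<open>?Z\<close> next to \<open>?M\<close>, so that the two
    cancel and \<open>?D * ?T\<close> remains.\<close>
  also have "\<dots> = ?D * (?Z * (?M * ?T))"
    by (rule assoc_mult_mat[where n\<^sub>1 = n and n\<^sub>2 = n and n\<^sub>3 = n and n\<^sub>4 = n])
      (simp_all add: mult_carrier_mat[of _ n n])
  also have "?Z * (?M * ?T) = ?Z * ?M * ?T"
    by (rule assoc_mult_mat[symmetric]) (rule mats_carrier)+
  also have "\<dots> = ?T"
    by (simp add: zeta_mat_times_moebius_mat[OF assms(1,2)] left_mult_one_mat[of _ n n])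
  also have "?D * ?T = 1\<^sub>m n"
    using assms(4,5) by (rule psi_mat_times_theta_mat)
  finally show ?thesis .
qed

text \<open>This serves the necessity of the condition, where some \<open>Psi'\<close> might be 0
  and \<open>theta'\<close> cannot supply an inverse.\<close>

lemma det_psi_mat:
  assumes "\<And>i j. \<lbrakk>i < n; j < n; x i \<le> x j\<rbrakk> \<Longrightarrow> i \<le> j"
  shows "det (psi_mat n S x f) = (\<Prod>i<n. Psi' S (f i) (x i))"
proof -
  have "e' x i j = 0" if "i < n" "j < i" for i j
    using that assms[of i j] by (auto simp: e'_def)
  then have "upper_triangular (psi_mat n S x f)"
    by (simp add: upper_triangular_def psi_mat_def)
  then have "det (psi_mat n S x f) = prod_list (diag_mat (psi_mat n S x f))"
    by (rule det_upper_triangular) (rule mats_carrier)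
  also have "\<dots> = (\<Prod>i<n. Psi' S (f i) (x i))"
    by (simp add: prod_list_diag_prod psi_mat_def e'_def atLeast0LessThan)
  finally show ?thesis .
qed

lemma det_nonzero_if_invertible:
  fixes A :: "'a::idom mat"
  assumes "invertible_mat A" and A: "A \<in> carrier_mat n n"
  shows "det A \<noteq> 0"
proof -
  from assms obtain C where AC: "A * C = 1\<^sub>m n" and CA: "C * A = 1\<^sub>m (dim_row C)"
    by (auto simp: invertible_mat_def inverts_mat_def)
  \<comment> \<open>\<open>inverts_mat\<close> does not fix the size of \<open>C\<close>; both
    dimensions are read off from the columns of the two products.\<close>
  have "dim_col C = n"
    using arg_cong[OF AC, of dim_col] by simp
  moreover have "dim_row C = n"
    using arg_cong[OF CA, of dim_col] A by simp
  ultimately have "det (A * C) = det A * det C"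
    by (intro det_mult[OF A] carrier_matI)
  then show ?thesis
    unfolding AC by auto
qed

theorem theorem7p4:
  fixes n :: nat
    and x :: "nat \<Rightarrow> 'a::lattice"
    and S :: "'a set"
    and f :: "nat \<Rightarrow> 'a \<Rightarrow> complex"
  assumes "S = x ` {..<n}"
    and "inj_on x {..<n}"
    and "\<And>i j. \<lbrakk>i < n; j < n; x i \<le> x j\<rbrakk> \<Longrightarrow> i \<le> j"
    and "join_closed S"
  shows "(invertible_mat (row_adj_join_mat n x f) \<longleftrightarrow> (\<forall>i<n. Psi' S (f i) (x i) \<noteq> 0)) \<and>
         (invertible_mat (row_adj_join_mat n x f) \<longrightarrow>
            inverts_mat (row_adj_join_mat n x f) (B' n S x f) \<and>
            inverts_mat (B' n S x f) (row_adj_join_mat n x f))"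
proof -
  let ?A = "row_adj_join_mat n x f" and ?B = "B' n S x f"
  have nz: "\<forall>i<n. Psi' S (f i) (x i) \<noteq> 0" if "invertible_mat ?A"
  proof -
    have "det ?A \<noteq> 0"
      using that by (rule det_nonzero_if_invertible) (rule mats_carrier)
    \<comment> \<open>The determinant of \<open>zeta_mat\<close> need not be computed: a nonzero
      product already forces every diagonal factor of \<open>psi_mat\<close> to be nonzero.\<close>
    also have "det ?A = det (psi_mat n S x f) * det (zeta_mat n x)"
      unfolding row_adj_join_mat_factor[OF assms(1,2,4)]
      by (rule det_mult) (rule mats_carrier)+
    finally show ?thesis
      by (simp add: det_psi_mat[OF assms(3)])
  qed
  have inv: "inverts_mat ?A ?B \<and> inverts_mat ?B ?A" if "\<forall>i<n. Psi' S (f i) (x i) \<noteq> 0"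
  proof -
    have AB: "?A * ?B = 1\<^sub>m n"
      using assms that by (intro row_adj_join_mat_times_B') auto
    \<comment> \<open>For square matrices over a field a right inverse is also a left
      inverse.\<close>
    then have "?B * ?A = 1\<^sub>m n"
      by (intro mat_mult_left_right_inverse[OF _ _ AB]) (rule mats_carrier)+
    with AB show ?thesis
      by (simp add: inverts_mat_def carrier_matD(1)[of _ n n])
  qed
  have "invertible_mat ?A" if "\<forall>i<n. Psi' S (f i) (x i) \<noteq> 0"
    using inv[OF that] unfolding invertible_mat_def
    by (auto simp: carrier_matD[of _ n n])
  with nz inv show ?thesis
    by blast
qed

end
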